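(* Let $F$ be a free group and let $G$ be a subgroup of $F$ whose normal closure in $F$ is not equal to $F$. Then $G_2$ never contains $F_m$ for any integer $m \geq 1$.
   Context: For a group $\Gamma$, $\Gamma_m$ denotes the $m$th term of the lower central series, defined by $\Gamma_1 = \Gamma$ and $\Gamma_{m+1} = [\Gamma_m, \Gamma]$ for $m \geq 1$. In particular $G_2 = [G,G]$ is the commutator subgroup of $G$, regarded as a subgroup of $F$. The free group $F$ is of arbitrary rank (possibly infinite). The normal closure of $G$ in $F$ is the smallest normal subgroup of $F$ containing $G$.
   Formalization: The free group F is assumed non-abelian (rank at least 2); for F infinite cyclic and G any proper subgroup, F_2 is trivial and so is contained in G_2, so the claim as stated fails. *)

theory Defs
  imports "HOL-Algebra.Algebra"
begin

section \<open>Free groups\<close>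

text \<open>
  A letter \<open>(True, x)\<close> stands for the generator \<open>x\<close> and \<open>(False, x)\<close> for its formal inverse.
  The free group on \<open>S\<close> consists of the words over \<open>S\<close> modulo insertion and deletion of adjacent
  pairs of mutually inverse letters.
\<close>

definition free_words :: "'a set \<Rightarrow> (bool \<times> 'a) list set" where
  "free_words S = lists (UNIV \<times> S)"

inductive_set free_cong :: "'a set \<Rightarrow> ((bool \<times> 'a) list \<times> (bool \<times> 'a) list) set"
  for S where
  refl: "w \<in> free_words S \<Longrightarrow> (w, w) \<in> free_cong S"
| sym: "(u, v) \<in> free_cong S \<Longrightarrow> (v, u) \<in> free_cong S"
| trans: "(u, v) \<in> free_cong S \<Longrightarrow> (v, w) \<in> free_cong S \<Longrightarrow> (u, w) \<in> free_cong S"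
| cancel: "u \<in> free_words S \<Longrightarrow> v \<in> free_words S \<Longrightarrow> x \<in> S \<Longrightarrow>
    (u @ [(b, x), (\<not> b, x)] @ v, u @ v) \<in> free_cong S"

definition free_group :: "'a set \<Rightarrow> (bool \<times> 'a) list set monoid" where
  "free_group S =
    \<lparr> carrier = free_words S // free_cong S,
      monoid.mult = (\<lambda>U V. \<Union>u\<in>U. \<Union>v\<in>V. free_cong S `` {u @ v}),
      one = free_cong S `` {[]} \<rparr>"

text \<open>
  There is no loss of generality in taking the index set \<open>S\<close> of the basis in the type of the
  elements of \<open>F\<close>, since a basis of \<open>F\<close> is itself a subset of \<open>carrier F\<close>.
\<close>

definition is_free_group :: "('a, 'b) monoid_scheme \<Rightarrow> bool" where
  "is_free_group F \<longleftrightarrow> group F \<and> (\<exists>S :: 'a set. free_group S \<cong> F)"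

lemma free_cong_words:
  assumes "(u, v) \<in> free_cong S"
  shows "u \<in> free_words S" "v \<in> free_words S"
  using assms by (induction) (auto simp: free_words_def)

lemma equiv_free_cong: "equiv (free_words S) (free_cong S)"
  by (rule equivI) (auto intro!: refl_onI symI transI intro: free_cong.intros dest: free_cong_words)

lemma free_cong_append_right:
  assumes "(u, v) \<in> free_cong S" "w \<in> free_words S"
  shows "(u @ w, v @ w) \<in> free_cong S"
  using assms
proof (induction)
  case (cancel u v x b)
  then show ?case
    using free_cong.cancel[of u S "v @ w" x b] by (auto simp: free_words_def)
qed (auto intro: free_cong.intros simp: free_words_def)

lemma free_cong_append_left:
  assumes "(u, v) \<in> free_cong S" "w \<in> free_words S"
  shows "(w @ u, w @ v) \<in> free_cong S"
  using assms
proof (induction)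
  case (cancel u v x b)
  then show ?case
    using free_cong.cancel[of "w @ u" S v x b] by (auto simp: free_words_def)
qed (auto intro: free_cong.intros simp: free_words_def)

lemma free_group_mult:
  assumes "u \<in> free_words S" "v \<in> free_words S"
  shows "free_cong S `` {u} \<otimes>\<^bsub>free_group S\<^esub> free_cong S `` {v} = free_cong S `` {u @ v}"
proof -
  have "congruent2 (free_cong S) (free_cong S) (\<lambda>u v. free_cong S `` {u @ v})"
  proof (rule congruent2I[OF equiv_free_cong equiv_free_cong])
    fix u u' v assume "(u, u') \<in> free_cong S" "v \<in> free_words S"
    then show "free_cong S `` {u @ v} = free_cong S `` {u' @ v}"
      by (intro equiv_class_eq[OF equiv_free_cong] free_cong_append_right)
  next
    fix u u' v assume "(u, u') \<in> free_cong S" "v \<in> free_words S"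
    then show "free_cong S `` {v @ u} = free_cong S `` {v @ u'}"
      by (intro equiv_class_eq[OF equiv_free_cong] free_cong_append_left)
  qed
  from UN_equiv_class2[OF equiv_free_cong equiv_free_cong this assms]
  show ?thesis by (simp add: free_group_def)
qed

lemma free_words_inverse:
  assumes "w \<in> free_words S"
  shows "\<exists>w' \<in> free_words S. (w' @ w, []) \<in> free_cong S"
  using assms
proof (induction w)
  case Nil
  then show ?case by (auto intro!: bexI[of _ "[]"] free_cong.refl simp: free_words_def)
next
  case (Cons a w)
  obtain b x where a: "a = (b, x)" by (cases a)
  have w: "w \<in> free_words S" and x: "x \<in> S" using Cons.prems by (auto simp: free_words_def a)
  then obtain w' where w': "w' \<in> free_words S" "(w' @ w, []) \<in> free_cong S" using Cons.IH by blast
  have "(w' @ [(\<not> b, x), (\<not> \<not> b, x)] @ w, w' @ w) \<in> free_cong S"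
    by (rule free_cong.cancel[OF w'(1) w x])
  then have "((w' @ [(\<not> b, x)]) @ a # w, []) \<in> free_cong S"
    using w'(2) by (auto simp: a intro: free_cong.trans)
  moreover have "w' @ [(\<not> b, x)] \<in> free_words S" using w'(1) x by (auto simp: free_words_def)
  ultimately show ?case by blast
qed

lemma free_group_is_group: "group (free_group S)"
proof (rule groupI)
  have carr: "U \<in> carrier (free_group S) \<longleftrightarrow> (\<exists>u \<in> free_words S. U = free_cong S `` {u})" for U
    by (auto simp: free_group_def quotient_def)
  have one: "\<one>\<^bsub>free_group S\<^esub> = free_cong S `` {[]}" by (simp add: free_group_def)
  have app: "u @ v \<in> free_words S" if "u \<in> free_words S" "v \<in> free_words S" for u v
    using that by (auto simp: free_words_def)
  have nil: "[] \<in> free_words S" by (simp add: free_words_def)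
  show "\<one>\<^bsub>free_group S\<^esub> \<in> carrier (free_group S)" unfolding carr one using nil by blast
  fix U assume "U \<in> carrier (free_group S)"
  then obtain u where u: "u \<in> free_words S" "U = free_cong S `` {u}" by (auto simp: carr)
  show "\<one>\<^bsub>free_group S\<^esub> \<otimes>\<^bsub>free_group S\<^esub> U = U"
    by (simp add: u one free_group_mult nil)
  obtain u' where u': "u' \<in> free_words S" "(u' @ u, []) \<in> free_cong S"
    using free_words_inverse[OF u(1)] by blast
  then show "\<exists>V\<in>carrier (free_group S). V \<otimes>\<^bsub>free_group S\<^esub> U = \<one>\<^bsub>free_group S\<^esub>"
    by (intro bexI[of _ "free_cong S `` {u'}"])
       (auto simp: u one free_group_mult carr intro: free_cong.intros)
  fix V assume "V \<in> carrier (free_group S)"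
  then obtain v where v: "v \<in> free_words S" "V = free_cong S `` {v}" by (auto simp: carr)
  show "U \<otimes>\<^bsub>free_group S\<^esub> V \<in> carrier (free_group S)"
    using app[OF u(1) v(1)] by (auto simp: carr u v free_group_mult)
  fix W assume "W \<in> carrier (free_group S)"
  then obtain w where w: "w \<in> free_words S" "W = free_cong S `` {w}" by (auto simp: carr)
  show "U \<otimes>\<^bsub>free_group S\<^esub> V \<otimes>\<^bsub>free_group S\<^esub> W = U \<otimes>\<^bsub>free_group S\<^esub> (V \<otimes>\<^bsub>free_group S\<^esub> W)"
    by (simp add: u v w free_group_mult app)
qed

section \<open>Normal closure\<close>

definition normal_closure :: "('a, 'b) monoid_scheme \<Rightarrow> 'a set \<Rightarrow> 'a set" where
  "normal_closure F S = \<Inter> {N. N \<lhd> F \<and> S \<subseteq> N}"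

section \<open>Lower central series\<close>

definition commutator_subgroup :: "('a, 'b) monoid_scheme \<Rightarrow> 'a set \<Rightarrow> 'a set \<Rightarrow> 'a set" where
  "commutator_subgroup G A B =
    generate G (\<Union>a \<in> A. \<Union>b \<in> B. {a \<otimes>\<^bsub>G\<^esub> b \<otimes>\<^bsub>G\<^esub> inv\<^bsub>G\<^esub> a \<otimes>\<^bsub>G\<^esub> inv\<^bsub>G\<^esub> b})"

text \<open>The series is indexed from 1; the value at 0 is a dummy.\<close>

fun lower_central :: "('a, 'b) monoid_scheme \<Rightarrow> nat \<Rightarrow> 'a set" where
  "lower_central G 0 = carrier G"
| "lower_central G (Suc 0) = carrier G"
| "lower_central G (Suc (Suc m)) = commutator_subgroup G (lower_central G (Suc m)) (carrier G)"

lemma commutator_subgroup_self: "commutator_subgroup G H H = derived G H"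
  by (simp add: commutator_subgroup_def derived_def)

lemma (in group) lower_central_2_subgroup:
  assumes "subgroup H G"
  shows "lower_central (G\<lparr>carrier := H\<rparr>) 2 = derived G H"
  using derived_consistent[OF subset_refl assms]
  by (simp add: numeral_2_eq_2 commutator_subgroup_self)

text \<open>
  In an abelian group the second term of the lower central series is trivial, hence contained in
  the commutator subgroup of every subgroup.  A free group whose commutator subgroups are compared
  with its lower central series must therefore be non-abelian: the infinite cyclic group and its
  subgroup of index 2 are a counterexample otherwise.
\<close>

lemma (in comm_group) lower_central_2_abelian:
  assumes "subgroup H G"
  shows "lower_central G 2 \<subseteq> lower_central (G\<lparr>carrier := H\<rparr>) 2"
  using lower_central_2_subgroup[OF assms] lower_central_2_subgroup[OF subgroup_self]
    derived_eq_singleton subgroup.subset[OF assms]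
  by simp

end

theory Submission
  imports Defs
begin

text \<open>
  If \<open>F\<^sub>m\<close> were contained in \<open>[G, G]\<close>, it would be contained in a proper normal subgroup \<open>N \<supseteq> G\<close>.
  Then \<open>F/N\<close> is nilpotent and nontrivial, so its abelianization \<open>A\<close> is nontrivial and some free
  generator \<open>s\<close> has nontrivial image \<open>a\<close> in \<open>A\<close>. As \<open>F\<close> is not abelian there is another
  generator \<open>t\<close>. Let \<open>d\<close> be the crossed homomorphism from \<open>F\<close> to the integer-valued functions on \<open>A\<close>
  that sends \<open>t\<close> to the indicator of the identity and all other generators to \<open>0\<close>. On \<open>G\<close>, which
  acts trivially, \<open>d\<close> is a homomorphism to an abelian group, so it vanishes on \<open>[G, G]\<close>. But it maps
  the iterated commutator \<open>[\<dots>[[t, s], s], \<dots>, s]\<close> to an iterated difference \<open>(1 - a)\<^sup>k\<close> of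
  the indicator. This is never zero: all these functions are bounded, and a bounded function
  killed by \<open>(1 - a)\<^sup>2\<close> is already killed by \<open>1 - a\<close>.
\<close>

section \<open>Crossed homomorphisms on free groups\<close>

definition free_gen :: "'a set \<Rightarrow> 'a \<Rightarrow> (bool \<times> 'a) list set" where
  "free_gen S x = free_cong S `` {[(True, x)]}"

definition letter_val :: "('c, 'd) monoid_scheme \<Rightarrow> ('a \<Rightarrow> 'c) \<Rightarrow> bool \<times> 'a \<Rightarrow> 'c" where
  "letter_val A g p = (if fst p then g (snd p) else inv\<^bsub>A\<^esub> g (snd p))"

primrec word_val :: "('c, 'd) monoid_scheme \<Rightarrow> ('a \<Rightarrow> 'c) \<Rightarrow> (bool \<times> 'a) list \<Rightarrow> 'c" where
  "word_val A g [] = \<one>\<^bsub>A\<^esub>"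
| "word_val A g (p # w) = letter_val A g p \<otimes>\<^bsub>A\<^esub> word_val A g w"

text \<open>
  \<open>fox A g v w c\<close> sums the edge weights \<open>v\<close> along the path in the Cayley graph of \<open>A\<close> that starts
  at \<open>c\<close> and reads the word \<open>w\<close>; an edge traversed backwards counts negatively.
\<close>

primrec fox ::
  "('c, 'd) monoid_scheme \<Rightarrow> ('a \<Rightarrow> 'c) \<Rightarrow> ('a \<Rightarrow> 'c \<Rightarrow> 'e::ab_group_add) \<Rightarrow> (bool \<times> 'a) list \<Rightarrow> 'c \<Rightarrow> 'e"
  where
  "fox A g v [] c = 0"
| "fox A g v (p # w) c =
    (if fst p then v (snd p) c else - v (snd p) (c \<otimes>\<^bsub>A\<^esub> inv\<^bsub>A\<^esub> g (snd p)))
    + fox A g v w (c \<otimes>\<^bsub>A\<^esub> letter_val A g p)"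

lemma nil_free_words: "[] \<in> free_words S"
  by (simp add: free_words_def)

lemma Cons_free_words: "p # w \<in> free_words S \<longleftrightarrow> snd p \<in> S \<and> w \<in> free_words S"
  by (cases p) (auto simp: free_words_def)

lemma append_free_words: "u @ v \<in> free_words S \<longleftrightarrow> u \<in> free_words S \<and> v \<in> free_words S"
  by (auto simp: free_words_def)

lemma carrier_free_group_iff:
  "U \<in> carrier (free_group S) \<longleftrightarrow> (\<exists>u \<in> free_words S. U = free_cong S `` {u})"
  by (auto simp: free_group_def quotient_def)

lemma one_free_group: "\<one>\<^bsub>free_group S\<^esub> = free_cong S `` {[]}"
  by (simp add: free_group_def)

lemma free_gen_carrier: "x \<in> S \<Longrightarrow> free_gen S x \<in> carrier (free_group S)"
  unfolding carrier_free_group_iff free_gen_def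
  by (intro bexI[of _ "[(True, x)]"]) (auto simp: Cons_free_words nil_free_words)

context group
begin

lemma letter_val_closed:
  assumes "g ` S \<subseteq> carrier G" "snd p \<in> S"
  shows "letter_val G g p \<in> carrier G"
  using assms by (auto simp: letter_val_def)

lemma word_val_closed:
  assumes "g ` S \<subseteq> carrier G" "w \<in> free_words S"
  shows "word_val G g w \<in> carrier G"
  using assms(2)
  by (induction w) (auto simp: Cons_free_words intro!: m_closed letter_val_closed[OF assms(1)])

lemma word_val_append:
  assumes g: "g ` S \<subseteq> carrier G" and "u \<in> free_words S" "w \<in> free_words S"
  shows "word_val G g (u @ w) = word_val G g u \<otimes> word_val G g w"
  using assms(2)
  by (induction u)
    (auto simp: Cons_free_words m_assoc word_val_closed[OF g] letter_val_closed[OF g] assms(3))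

lemma fox_append:
  assumes g: "g ` S \<subseteq> carrier G" and "u \<in> free_words S" "c \<in> carrier G"
  shows "fox G g v (u @ w) c = fox G g v u c + fox G g v w (c \<otimes> word_val G g u)"
  using assms(2,3)
  by (induction u arbitrary: c)
    (auto simp: Cons_free_words m_assoc word_val_closed[OF g] letter_val_closed[OF g] add.assoc)

text \<open>A cancelling pair of letters traverses an edge and returns along it at once: the
  endpoint is unchanged and the two weights cancel. So both values descend to the free
  group.\<close>

lemma free_cong_word_val_fox:
  assumes g: "g ` S \<subseteq> carrier G" and "(u, w) \<in> free_cong S"
  shows "word_val G g u = word_val G g w \<and> (\<forall>c\<in>carrier G. fox G g v u c = fox G g v w c)"
  using assms(2)
proof (induction rule: free_cong.induct)
  case (cancel u w x b)
  let ?p = "[(b, x), (\<not> b, x)]"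
  have gx: "g x \<in> carrier G" using g cancel by auto
  have p: "?p \<in> free_words S" using cancel by (auto simp: free_words_def)
  have 1: "word_val G g ?p = \<one>" using gx by (simp add: letter_val_def)
  have 2: "fox G g v ?p c = 0" if "c \<in> carrier G" for c
    using gx that by (cases b) (simp_all add: letter_val_def m_assoc)
  have "word_val G g (u @ ?p @ w) = word_val G g (u @ w)"
    using cancel p 1 word_val_closed[OF g cancel(2)]
    by (simp only: word_val_append[OF g] append_free_words simp_thms l_one)
  moreover have "fox G g v (u @ ?p @ w) c = fox G g v (u @ w) c" if "c \<in> carrier G" for c
    using cancel p 1 2 that word_val_closed[OF g cancel(1)]
    by (simp only: fox_append[OF g] append_free_words simp_thms r_one m_closed add_0)
  ultimately show ?case by blast
qed auto

end

section \<open>Homomorphisms out of free groups and their generators\<close>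

lemma inv_free_gen:
  assumes "x \<in> S"
  shows "inv\<^bsub>free_group S\<^esub> free_gen S x = free_cong S `` {[(False, x)]}"
proof -
  interpret FG: group "free_group S" by (rule free_group_is_group)
  have w: "[(b, x)] \<in> free_words S" for b using assms by (auto simp: free_words_def)
  have "([(False, x), (True, x)], []) \<in> free_cong S"
    using free_cong.cancel[OF nil_free_words nil_free_words assms, of False] by simp
  then have "free_cong S `` {[(False, x), (True, x)]} = free_cong S `` {[]}"
    by (rule equiv_class_eq[OF equiv_free_cong])
  then have "free_cong S `` {[(False, x)]} \<otimes>\<^bsub>free_group S\<^esub> free_gen S x = \<one>\<^bsub>free_group S\<^esub>"
    by (simp add: free_gen_def free_group_mult w one_free_group)
  then show ?thesis
  proof (rule FG.inv_equality)
    show "free_cong S `` {[(False, x)]} \<in> carrier (free_group S)"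
      using w by (auto simp: carrier_free_group_iff)
  qed (rule free_gen_carrier[OF assms])
qed

lemma hom_free_cong_class:
  assumes "group A" "h \<in> hom (free_group S) A" "w \<in> free_words S"
  shows "h (free_cong S `` {w}) = word_val A (h \<circ> free_gen S) w"
proof -
  interpret group_hom "free_group S" A h
    using assms free_group_is_group by (simp add: group_hom_def group_hom_axioms_def)
  show ?thesis using assms(3)
  proof (induction w)
    case Nil
    show ?case using hom_one by (simp add: one_free_group)
  next
    case (Cons p w)
    then have x: "snd p \<in> S" and w: "w \<in> free_words S" by (auto simp: Cons_free_words)
    have p: "[p] \<in> free_words S" using x by (simp add: Cons_free_words nil_free_words)
    have "h (free_cong S `` {[p]}) = letter_val A (h \<circ> free_gen S) p"
      using inv_free_gen[OF x] free_gen_carrier[OF x] hom_inv[of "free_gen S (snd p)"]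
      by (cases p; cases "fst p") (auto simp: letter_val_def free_gen_def)
    moreover have "free_cong S `` {p # w}
        = free_cong S `` {[p]} \<otimes>\<^bsub>free_group S\<^esub> free_cong S `` {w}"
      using free_group_mult[OF p w] by simp
    moreover have "free_cong S `` {[p]} \<in> carrier (free_group S)"
      "free_cong S `` {w} \<in> carrier (free_group S)"
      using p w by (auto simp: carrier_free_group_iff)
    ultimately show ?case using Cons.IH[OF w] by (simp add: comp_def)
  qed
qed

lemma generate_free_gen: "generate (free_group S) (free_gen S ` S) = carrier (free_group S)"
proof -
  interpret FG: group "free_group S" by (rule free_group_is_group)
  have sub: "free_gen S ` S \<subseteq> carrier (free_group S)" by (auto simp: free_gen_carrier)
  have "word_val (free_group S) (free_gen S) w \<in> generate (free_group S) (free_gen S ` S)"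
    if "w \<in> free_words S" for w
    using that
    by (induction w)
      (auto simp: Cons_free_words letter_val_def intro: generate.intros)
  moreover have "free_cong S `` {w} = word_val (free_group S) (free_gen S) w"
    if "w \<in> free_words S" for w
    using hom_free_cong_class[OF free_group_is_group, of "\<lambda>x. x" S] that
    by (simp add: hom_def comp_def)
  ultimately show ?thesis
    using FG.generate_incl[OF sub] by (auto simp: carrier_free_group_iff)
qed

text \<open>
  Here \<open>F\<close> acts on functions on \<open>A\<close> through \<open>h\<close> by \<open>(x f)(c) = f (c h(x))\<close>, and the first
  property is the crossed homomorphism law \<open>d(xy) = d(x) + x d(y)\<close>.
\<close>

lemma free_group_crossed_hom:
  fixes v :: "'a \<Rightarrow> 'c \<Rightarrow> 'e::ab_group_add"
  assumes A: "group A" and h: "h \<in> hom (free_group S) A"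
  obtains d where
    "\<And>U V c. U \<in> carrier (free_group S) \<Longrightarrow> V \<in> carrier (free_group S) \<Longrightarrow> c \<in> carrier A \<Longrightarrow>
      d (U \<otimes>\<^bsub>free_group S\<^esub> V) c = d U c + d V (c \<otimes>\<^bsub>A\<^esub> h U)"
    "\<And>x c. x \<in> S \<Longrightarrow> c \<in> carrier A \<Longrightarrow> d (free_gen S x) c = v x c"
proof -
  interpret A: group A by (rule A)
  let ?g = "h \<circ> free_gen S"
  have g: "?g ` S \<subseteq> carrier A" using h by (auto simp: hom_def free_gen_carrier)
  \<comment> \<open>The choice of representative is immaterial: congruent words have the same
    \<open>fox\<close> value at each point of the carrier.\<close>
  define d where "d U = fox A ?g v (SOME w. w \<in> U)" for U
  have d: "d (free_cong S `` {w}) c = fox A ?g v w c" if "w \<in> free_words S" "c \<in> carrier A" for w c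
  proof -
    have "w \<in> free_cong S `` {w}" using free_cong.refl[OF that(1)] by simp
    then have "(SOME u. u \<in> free_cong S `` {w}) \<in> free_cong S `` {w}" by (rule someI)
    then have "(w, SOME u. u \<in> free_cong S `` {w}) \<in> free_cong S" by simp
    from A.free_cong_word_val_fox[OF g this, of v] that(2) show ?thesis
      by (simp add: d_def)
  qed
  show thesis
  proof
    fix U V c
    assume "U \<in> carrier (free_group S)" "V \<in> carrier (free_group S)" and c: "c \<in> carrier A"
    then obtain u w where u: "u \<in> free_words S" "U = free_cong S `` {u}"
      and w: "w \<in> free_words S" "V = free_cong S `` {w}"
      by (auto simp: carrier_free_group_iff)
    have uw: "u @ w \<in> free_words S" using u w by (simp add: append_free_words)
    have "d (U \<otimes>\<^bsub>free_group S\<^esub> V) c = fox A ?g v (u @ w) c"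
      by (simp only: u w free_group_mult d uw c)
    also have "\<dots> = fox A ?g v u c + fox A ?g v w (c \<otimes>\<^bsub>A\<^esub> word_val A ?g u)"
      by (rule A.fox_append[OF g u(1) c])
    also have "\<dots> = d U c + d V (c \<otimes>\<^bsub>A\<^esub> h U)"
      using A.word_val_closed[OF g u(1)]
      by (simp only: u w d hom_free_cong_class[OF A h] c A.m_closed)
    finally show "d (U \<otimes>\<^bsub>free_group S\<^esub> V) c = d U c + d V (c \<otimes>\<^bsub>A\<^esub> h U)" .
  next
    fix x c assume x: "x \<in> S" and c: "c \<in> carrier A"
    have "[(True, x)] \<in> free_words S" using x by (simp add: Cons_free_words nil_free_words)
    then show "d (free_gen S x) c = v x c" using c by (simp add: free_gen_def d)
  qed
qed

section \<open>Commutators and crossed homomorphisms\<close>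

text \<open>The function \<open>f\<close> is an arithmetic progression along every orbit of \<open>a\<close>.\<close>

lemma (in group) bounded_second_difference_zero:
  fixes f :: "'a \<Rightarrow> int"
  assumes a: "a \<in> carrier G"
    and bdd: "\<And>c. c \<in> carrier G \<Longrightarrow> \<bar>f c\<bar> \<le> B"
    and inv: "\<And>c. c \<in> carrier G \<Longrightarrow> f c - f (c \<otimes> a) = f (c \<otimes> a) - f (c \<otimes> a \<otimes> a)"
    and c: "c \<in> carrier G"
  shows "f c = f (c \<otimes> a)"
proof -
  define \<delta> where "\<delta> = f (c \<otimes> a) - f c"
  have step: "f (c \<otimes> a [^] n \<otimes> a) - f (c \<otimes> a [^] n) = \<delta>" for n :: nat
  proof (induction n)
    case (Suc n)
    then show ?case using inv[of "c \<otimes> a [^] n"] a c by (simp add: m_assoc)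
  qed (use a c in \<open>simp add: \<delta>_def\<close>)
  have prog: "f (c \<otimes> a [^] n) = f c + int n * \<delta>" for n :: nat
  proof (induction n)
    case (Suc n)
    then show ?case using step[of n] a c by (simp add: m_assoc algebra_simps)
  qed (use c in simp)
  have "\<delta> = 0"
  proof (rule ccontr)
    assume "\<delta> \<noteq> 0"
    \<comment> \<open>Two values of \<open>f\<close> differ by at most \<open>2 * B\<close>, whereas
      \<open>n\<close> steps of a nonconstant integer progression move it by at least
      \<open>n\<close>.\<close>
    define n where "n = nat (2 * B + 1)"
    have B: "0 \<le> B" using bdd[OF c] by simp
    have "int n * 1 \<le> int n * \<bar>\<delta>\<bar>" using \<open>\<delta> \<noteq> 0\<close> by (intro mult_left_mono) auto
    also have "\<dots> = \<bar>f (c \<otimes> a [^] n) - f c\<bar>" by (simp add: prog abs_mult)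
    also have "\<dots> \<le> 2 * B" using bdd[of "c \<otimes> a [^] n"] bdd[OF c] a c by simp
    finally show False using B by (simp add: n_def)
  qed
  then show ?thesis by (simp add: \<delta>_def)
qed

definition shift_diff :: "('c, 'd) monoid_scheme \<Rightarrow> 'c \<Rightarrow> ('c \<Rightarrow> 'e) \<Rightarrow> 'c \<Rightarrow> 'e::ab_group_add" where
  "shift_diff A a f c = f c - f (c \<otimes>\<^bsub>A\<^esub> a)"

text \<open>Exponents 0 and 1 are checked at the identity. Beyond that, if one more difference
  annihilated the indicator, \<open>bounded_second_difference_zero\<close> would make the preceding
  one vanish already, against the induction hypothesis.\<close>

lemma (in group) iterated_shift_diff_indicator:
  assumes a: "a \<in> carrier G" "a \<noteq> \<one>"
  shows "\<exists>c\<in>carrier G. (shift_diff G a ^^ n) (\<lambda>c. of_bool (c = \<one>)) c \<noteq> (0::int)"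
proof (induction n)
  case 0
  show ?case by (intro bexI[of _ \<one>]) auto
next
  let ?f = "\<lambda>n. (shift_diff G a ^^ n) (\<lambda>c. of_bool (c = \<one>)) :: 'a \<Rightarrow> int"
  have bdd: "\<exists>B. \<forall>c\<in>carrier G. \<bar>?f n c\<bar> \<le> B" for n
  proof (induction n)
    case 0
    show ?case by (intro exI[of _ 1]) auto
  next
    case (Suc n)
    then obtain B where B: "\<And>c. c \<in> carrier G \<Longrightarrow> \<bar>?f n c\<bar> \<le> B" by blast
    have "\<bar>?f (Suc n) c\<bar> \<le> 2 * B" if "c \<in> carrier G" for c
      using B[OF that] B[of "c \<otimes> a"] a that by (simp add: shift_diff_def)
    then show ?case by blast
  qed
  case (Suc n)
  show ?case
  proof (cases n)
    case 0
    then show ?thesis using a by (intro bexI[of _ \<one>]) (auto simp: shift_diff_def)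
  next
    case n: (Suc k)
    show ?thesis
    proof (rule ccontr)
      assume "\<not> ?thesis"
      then have zero: "?f (Suc (Suc k)) c = 0" if "c \<in> carrier G" for c using that n by blast
      obtain B where B: "\<And>c. c \<in> carrier G \<Longrightarrow> \<bar>?f k c\<bar> \<le> B" using bdd by blast
      have "?f (Suc k) c = 0" if "c \<in> carrier G" for c
      proof -
        have "?f k c = ?f k (c \<otimes> a)"
        proof (rule bounded_second_difference_zero[OF a(1) B _ that])
          fix c assume "c \<in> carrier G"
          then show "?f k c - ?f k (c \<otimes> a) = ?f k (c \<otimes> a) - ?f k (c \<otimes> a \<otimes> a)"
            using zero[of c] by (simp add: shift_diff_def)
        qed
        then show ?thesis by (simp add: shift_diff_def)
      qed
      then show False using Suc n by blast
    qed
  qed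
qed

locale crossed_hom = group_hom G H h
  for G (structure) and H (structure) and h +
  fixes d :: "'a \<Rightarrow> 'c \<Rightarrow> 'e::ab_group_add"
  assumes crossed_mult: "\<lbrakk>x \<in> carrier G; y \<in> carrier G; c \<in> carrier H\<rbrakk> \<Longrightarrow>
    d (x \<otimes> y) c = d x c + d y (c \<otimes>\<^bsub>H\<^esub> h x)"
begin

lemma crossed_one: "c \<in> carrier H \<Longrightarrow> d \<one> c = 0"
  using crossed_mult[of \<one> \<one> c] by simp

lemma crossed_inv:
  assumes "x \<in> carrier G" "c \<in> carrier H"
  shows "d (inv x) c = - d x (c \<otimes>\<^bsub>H\<^esub> inv\<^bsub>H\<^esub> h x)"
  using crossed_mult[of "inv x" x c] assms by (simp add: crossed_one eq_neg_iff_add_eq_0)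

lemma crossed_vanishes_derived:
  assumes K: "K \<subseteq> carrier G" and h: "\<And>x. x \<in> K \<Longrightarrow> h x = \<one>\<^bsub>H\<^esub>"
    and x: "x \<in> derived G K" and c: "c \<in> carrier H"
  shows "d x c = 0"
proof -
  have gen: "y \<in> carrier G \<and> h y = \<one>\<^bsub>H\<^esub> \<and> d y c = 0"
    if y: "y \<in> derived_set G K" and c: "c \<in> carrier H" for y c
  proof -
    obtain a b where "a \<in> K" "b \<in> K" and y: "y = a \<otimes> b \<otimes> inv a \<otimes> inv b"
      using y by auto
    then have "a \<in> carrier G" "b \<in> carrier G" "h a = \<one>\<^bsub>H\<^esub>" "h b = \<one>\<^bsub>H\<^esub>" using K h by auto
    then show ?thesis using c by (simp add: y crossed_mult crossed_inv)
  qed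
  from x have "x \<in> generate G (derived_set G K)" by (simp add: derived_def)
  \<comment> \<open>The induction carries triviality under \<open>h\<close> along, since a trivially
    acting left factor turns the crossed law into additivity.\<close>
  then have "x \<in> carrier G \<and> h x = \<one>\<^bsub>H\<^esub> \<and> (\<forall>c\<in>carrier H. d x c = 0)"
  proof (induction rule: generate.induct)
    case (inv y)
    have "y \<in> carrier G" "h y = \<one>\<^bsub>H\<^esub>" "\<And>c. c \<in> carrier H \<Longrightarrow> d y c = 0"
      using gen[OF inv] by blast+
    then show ?case by (simp add: crossed_inv)
  qed (use gen in \<open>auto simp: crossed_one crossed_mult\<close>)
  then show ?thesis using c by blast
qed

text \<open>The factors \<open>s\<close> and \<open>inv s\<close> contribute nothing. The factor
  \<open>inv x\<close> contributes \<open>- d x\<close> at \<open>c\<close> translated by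
  \<open>h x\<close>, \<open>h s\<close> and the inverse of \<open>h x\<close>; as \<open>H\<close>
  is abelian, only the translation by \<open>h s\<close> survives.\<close>

lemma crossed_commutator:
  assumes "comm_group H"
    and x: "x \<in> carrier G" and s: "s \<in> carrier G" "\<And>c. c \<in> carrier H \<Longrightarrow> d s c = 0"
    and c: "c \<in> carrier H"
  shows "d (x \<otimes> s \<otimes> inv x \<otimes> inv s) c = d x c - d x (c \<otimes>\<^bsub>H\<^esub> h s)"
proof -
  interpret CH: comm_group H by (rule assms(1))
  have "c \<otimes>\<^bsub>H\<^esub> (h x \<otimes>\<^bsub>H\<^esub> h s) \<otimes>\<^bsub>H\<^esub> inv\<^bsub>H\<^esub> h x = c \<otimes>\<^bsub>H\<^esub> h s"
    using x s(1) c by (simp add: CH.m_ac)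
  then show ?thesis using x s c by (simp add: crossed_mult crossed_inv)
qed

end

section \<open>Lower central series, images and iterated commutators\<close>

lemma (in group) commutator_subset_carrier:
  assumes "A \<subseteq> carrier G"
  shows "(\<Union>a\<in>A. \<Union>b\<in>carrier G. {a \<otimes> b \<otimes> inv a \<otimes> inv b}) \<subseteq> carrier G"
  using assms by auto

lemma (in group) lower_central_subset: "lower_central G k \<subseteq> carrier G"
proof (induction k)
  case (Suc k)
  then show ?case
    using generate_incl[OF commutator_subset_carrier[OF Suc]]
    \<comment> \<open>Index 0 is a dummy: the step from 0 to 1 stays at the carrier, and commutators
      enter only from 1 on.\<close>
    by (cases k) (simp_all add: commutator_subgroup_def)
qed simp

lemma (in group_hom) lower_central_img:
  assumes surj: "h ` carrier G = carrier H"
  shows "lower_central H k = h ` lower_central G k"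
proof (induction k)
  case (Suc k)
  let ?C = "\<Union>a\<in>lower_central G k. \<Union>b\<in>carrier G. {a \<otimes> b \<otimes> inv a \<otimes> inv b}"
  have sub: "lower_central G k \<subseteq> carrier G" by (rule G.lower_central_subset)
  have "h (a \<otimes> b \<otimes> inv a \<otimes> inv b) = h a \<otimes>\<^bsub>H\<^esub> h b \<otimes>\<^bsub>H\<^esub> inv\<^bsub>H\<^esub> h a \<otimes>\<^bsub>H\<^esub> inv\<^bsub>H\<^esub> h b"
    if "a \<in> lower_central G k" "b \<in> carrier G" for a b
    using that sub by (simp add: subset_iff)
  then have "h ` ?C = (\<Union>a\<in>h ` lower_central G k. \<Union>b\<in>h ` carrier G.
      {a \<otimes>\<^bsub>H\<^esub> b \<otimes>\<^bsub>H\<^esub> inv\<^bsub>H\<^esub> a \<otimes>\<^bsub>H\<^esub> inv\<^bsub>H\<^esub> b})"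
    by (simp add: image_UN)
  then have "commutator_subgroup H (lower_central H k) (carrier H)
      = h ` commutator_subgroup G (lower_central G k) (carrier G)"
    using generate_img[OF G.commutator_subset_carrier[OF sub]]
    by (simp add: commutator_subgroup_def Suc surj)
  then show ?case using surj by (cases k) simp_all
qed (simp add: surj)

text \<open>Used to see that a nontrivial group with a trivial lower central term is not
  perfect.\<close>

lemma lower_central_perfect:
  assumes "derived G (carrier G) = carrier G"
  shows "lower_central G k = carrier G"
proof (induction k)
  case (Suc k)
  then show ?case using assms by (cases k) (simp_all add: commutator_subgroup_self)
qed simp

text \<open>The witness is the left-normed commutator of \<open>x\<close> with \<open>k\<close>
  copies of \<open>s\<close>, each of which applies one \<open>shift_diff\<close> by
  \<open>crossed_commutator\<close>. It lies in term \<open>Suc k\<close> because the series starts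
  at index 1.\<close>

lemma (in crossed_hom) iterated_commutator:
  assumes "comm_group H"
    and x: "x \<in> carrier G" and s: "s \<in> carrier G" "\<And>c. c \<in> carrier H \<Longrightarrow> d s c = 0"
  shows "\<exists>w \<in> lower_central G (Suc k). \<forall>c \<in> carrier H.
    d w c = (shift_diff H (h s) ^^ k) (d x) c"
proof (induction k)
  case 0
  show ?case using x by auto
next
  case (Suc k)
  then obtain w where w: "w \<in> lower_central G (Suc k)"
    and dw: "\<And>c. c \<in> carrier H \<Longrightarrow> d w c = (shift_diff H (h s) ^^ k) (d x) c" by blast
  have "w \<in> carrier G" using w G.lower_central_subset by blast
  then have "d (w \<otimes> s \<otimes> inv w \<otimes> inv s) c = (shift_diff H (h s) ^^ Suc k) (d x) c"
    if "c \<in> carrier H" for c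
    using that s by (simp add: crossed_commutator[OF assms(1)] dw shift_diff_def)
  moreover have "w \<otimes> s \<otimes> inv w \<otimes> inv s \<in> lower_central G (Suc (Suc k))"
    using w s(1) by (auto simp: commutator_subgroup_def intro: generate.incl)
  ultimately show ?case by blast
qed

text \<open>
  \<open>A\<close> is the abelianization of \<open>G/N\<close>; were it trivial, \<open>G/N\<close> would be perfect as well as nilpotent.
\<close>

lemma (in group) nilpotent_quotient_abelian_image:
  assumes N: "N \<lhd> G" "N \<noteq> carrier G" and m: "lower_central G m \<subseteq> N"
  obtains A :: "'a set set monoid" and h where
    "comm_group A" "h \<in> hom G A" "h ` carrier G = carrier A" "carrier A \<noteq> {\<one>\<^bsub>A\<^esub>}"
    "\<And>x. x \<in> N \<Longrightarrow> h x = \<one>\<^bsub>A\<^esub>"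
proof -
  interpret N: normal N G by (rule N(1))
  let ?Q = "G Mod N" and ?p = "\<lambda>x. N #> x"
  interpret Q: group ?Q by (rule N.factorgroup_is_group)
  let ?D = "derived ?Q (carrier ?Q)"
  let ?A = "?Q Mod ?D" and ?q = "\<lambda>x. ?D #>\<^bsub>?Q\<^esub> x"
  interpret D: normal ?D ?Q by (rule Q.derived_self_is_normal)
  interpret A: comm_group ?A by (rule Q.derived_quot_is_comm_group)
  interpret p: group_hom G ?Q ?p
    using N.r_coset_hom_Mod by (simp add: group_hom_def group_hom_axioms_def is_group Q.is_group)
  have p_surj: "?p ` carrier G = carrier ?Q" by (auto simp: FactGroup_def RCOSETS_def)
  have q_surj: "?q ` carrier ?Q = carrier ?A" by (auto simp: FactGroup_def RCOSETS_def)
  have p_one: "?p x = \<one>\<^bsub>?Q\<^esub>" if "x \<in> N" for x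
    using coset_join2[OF _ N.subgroup_axioms that] that N.subset by (auto simp: FactGroup_def)
  \<comment> \<open>The lower central series of the quotient is the image of that of
    \<open>G\<close>, and the term with index \<open>m\<close> dies because it lies in
    \<open>N\<close>.\<close>
  have "lower_central ?Q m \<subseteq> {\<one>\<^bsub>?Q\<^esub>}"
    using p.lower_central_img[OF p_surj, of m] m p_one by auto
  moreover have "carrier ?Q \<noteq> {\<one>\<^bsub>?Q\<^esub>}"
  proof
    assume Q1: "carrier ?Q = {\<one>\<^bsub>?Q\<^esub>}"
    have "x \<in> N" if "x \<in> carrier G" for x
    proof -
      have "?p x = N" using Q1 p_surj that by (auto simp: FactGroup_def)
      then show ?thesis using rcos_self[OF that N.subgroup_axioms] by simp
    qed
    then show False using N(2) N.subset by blast
  qed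
  ultimately have "?D \<noteq> carrier ?Q"
    using lower_central_perfect[of ?Q m] Q.one_closed by auto
  moreover have "carrier ?A \<noteq> {\<one>\<^bsub>?A\<^esub>}" if "?D \<noteq> carrier ?Q"
  proof
    assume A1: "carrier ?A = {\<one>\<^bsub>?A\<^esub>}"
    have "x \<in> ?D" if "x \<in> carrier ?Q" for x
    proof -
      have "?q x = ?D" using A1 q_surj that by (auto simp: FactGroup_def)
      then show ?thesis using Q.rcos_self[OF that D.subgroup_axioms] by simp
    qed
    then show False using that D.subset by blast
  qed
  ultimately have A_nontriv: "carrier ?A \<noteq> {\<one>\<^bsub>?A\<^esub>}" by blast
  have hom: "?q \<circ> ?p \<in> hom G ?A"
    by (rule Group.hom_compose[OF N.r_coset_hom_Mod D.r_coset_hom_Mod])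
  have one: "(?q \<circ> ?p) x = \<one>\<^bsub>?A\<^esub>" if "x \<in> N" for x
    using p_one[OF that] Q.coset_join2[OF Q.one_closed D.subgroup_axioms D.one_closed]
    by (simp add: FactGroup_def)
  have surj: "(?q \<circ> ?p) ` carrier G = carrier ?A"
    by (simp only: image_comp[symmetric] p_surj q_surj)
  show thesis by (rule that[OF A.comm_group_axioms hom surj A_nontriv one])
qed

lemma (in group) comm_group_singleton_generator:
  assumes "x \<in> carrier G" "generate G {x} = carrier G"
  shows "comm_group G"
proof -
  have "subgroup_generated G {x} = G"
    using assms by (simp add: subgroup_generated_def)
  then have "cyclic_group G" by (auto simp: cyclic_group_alt)
  then show ?thesis by (rule cyclic_imp_abelian_group)
qed

section \<open>Lower central terms of a free group and commutators of its subgroups\<close>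

theorem theorem1p1:
  fixes F :: "('a, 'b) monoid_scheme" and G :: "'a set" and m :: nat
  assumes "is_free_group F"
    and "\<not> comm_group F"
    and "subgroup G F"
    and "normal_closure F G \<noteq> carrier F"
    and "m \<ge> 1"
  shows "\<not> lower_central F m \<subseteq> lower_central (F\<lparr>carrier := G\<rparr>) 2"
proof
  interpret F: group F using assms(1) by (simp add: is_free_group_def)
  assume "lower_central F m \<subseteq> lower_central (F\<lparr>carrier := G\<rparr>) 2"
  then have sub: "lower_central F m \<subseteq> derived F G"
    using F.lower_central_2_subgroup[OF assms(3)] by simp
  have G: "G \<subseteq> carrier F" using assms(3) by (rule subgroup.subset)
  \<comment> \<open>The closure is an intersection of normal subgroups containing \<open>G\<close>,
    so a point outside it is missed by one of them.\<close>
  obtain N where N: "N \<lhd> F" "G \<subseteq> N" "N \<noteq> carrier F"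
  proof -
    have "normal_closure F G \<subseteq> carrier F"
      using G F.normal_self by (auto simp: normal_closure_def)
    then obtain x where "x \<in> carrier F" "x \<notin> normal_closure F G" using assms(4) by blast
    then show thesis using that by (auto simp: normal_closure_def)
  qed
  have "derived F G \<subseteq> G" by (rule F.derived_incl[OF subset_refl assms(3)])
  then have "lower_central F m \<subseteq> N" using sub N(2) by blast
  from F.nilpotent_quotient_abelian_image[OF N(1,3) this]
  obtain A :: "'a set set monoid" and h where A: "comm_group A" and h: "h \<in> hom F A"
    and h_surj: "h ` carrier F = carrier A" and A_nontriv: "carrier A \<noteq> {\<one>\<^bsub>A\<^esub>}"
    and hN: "\<And>x. x \<in> N \<Longrightarrow> h x = \<one>\<^bsub>A\<^esub>" by blast
  interpret A: comm_group A by (rule A)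
  interpret h: group_hom F A h using h by unfold_locales
  obtain S :: "'a set" and \<phi> where \<phi>: "\<phi> \<in> iso (free_group S) F"
    using assms(1) by (auto simp: is_free_group_def is_iso_def)
  interpret FG: group "free_group S" by (rule free_group_is_group)
  interpret \<phi>: group_hom "free_group S" F \<phi> using \<phi> by unfold_locales (simp add: iso_def)
  have bij: "bij_betw \<phi> (carrier (free_group S)) (carrier F)" using \<phi> by (simp add: iso_def)
  let ?X = "\<lambda>x. \<phi> (free_gen S x)"
  have X: "x \<in> S \<Longrightarrow> ?X x \<in> carrier F" for x by (simp add: free_gen_carrier)
  have "generate F (\<phi> ` free_gen S ` S) = \<phi> ` carrier (free_group S)"
    using \<phi>.generate_img[of "free_gen S ` S"]
    by (simp add: generate_free_gen free_gen_carrier image_subset_iff)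
  then have gen: "generate F (?X ` S) = carrier F"
    using bij by (simp add: image_image bij_betw_def)

  obtain s where s: "s \<in> S" "h (?X s) \<noteq> \<one>\<^bsub>A\<^esub>"
  proof (rule ccontr)
    assume "\<not> thesis"
    then have "h ` ?X ` S \<subseteq> {\<one>\<^bsub>A\<^esub>}" using that by auto
    then have "generate A (h ` ?X ` S) \<subseteq> {\<one>\<^bsub>A\<^esub>}"
      using A.generate_subgroup_incl[OF _ A.triv_subgroup] by simp
    moreover have "generate A (h ` ?X ` S) = carrier A"
      using h.generate_img[of "?X ` S"] X gen h_surj by auto
    ultimately show False using A_nontriv A.one_closed by blast
  qed
  \<comment> \<open>Here the non-commutativity of \<open>F\<close> enters: a one-element basis would
    make \<open>F\<close> cyclic.\<close>
  obtain t where t: "t \<in> S" "t \<noteq> s"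
  proof (rule ccontr)
    assume "\<not> thesis"
    then have "S = {s}" using that s(1) by blast
    then have "generate F {?X s} = carrier F" using gen by simp
    then show False using F.comm_group_singleton_generator X s(1) assms(2) by blast
  qed

  \<comment> \<open>Only the edge labelled \<open>t\<close> that leaves the identity of
    \<open>A\<close> has weight 1. So \<open>t\<close> is sent to the indicator of the identity and
    \<open>s\<close>, being different from \<open>t\<close>, to 0.\<close>
  define v :: "'a \<Rightarrow> 'a set set \<Rightarrow> int" where "v x c = of_bool (x = t \<and> c = \<one>\<^bsub>A\<^esub>)" for x c
  have "h \<circ> \<phi> \<in> hom (free_group S) A" by (rule Group.hom_compose[OF \<phi>.homh h.homh])
  from free_group_crossed_hom[OF A.is_group this, of v] obtain e where
    e: "\<And>U V c. U \<in> carrier (free_group S) \<Longrightarrow> V \<in> carrier (free_group S) \<Longrightarrow> c \<in> carrier A \<Longrightarrow>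
        e (U \<otimes>\<^bsub>free_group S\<^esub> V) c = e U c + e V (c \<otimes>\<^bsub>A\<^esub> (h \<circ> \<phi>) U)"
      "\<And>x c. x \<in> S \<Longrightarrow> c \<in> carrier A \<Longrightarrow> e (free_gen S x) c = v x c" by blast
  \<comment> \<open>\<open>e\<close> lives on the word model of the free group; it is pulled back to
    \<open>F\<close> along the inverse of \<open>\<phi>\<close>.\<close>
  define \<psi> where "\<psi> = inv_into (carrier (free_group S)) \<phi>"
  have \<psi>: "\<psi> \<in> hom F (free_group S)"
    using FG.iso_set_sym[OF \<phi>] by (simp add: \<psi>_def iso_def)
  have \<phi>\<psi>: "\<phi> (\<psi> x) = x" if "x \<in> carrier F" for x
    using bij that by (simp add: \<psi>_def bij_betw_inv_into_right)
  have \<psi>X: "\<psi> (?X x) = free_gen S x" if "x \<in> S" for x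
    using bij that by (simp add: \<psi>_def bij_betw_inv_into_left free_gen_carrier)
  interpret crossed_hom F A h "\<lambda>x. e (\<psi> x)"
    using \<psi> e(1) \<phi>\<psi> by unfold_locales (auto simp: hom_def Pi_iff)

  \<comment> \<open>The term with index \<open>m\<close> is reached from \<open>t\<close> by
    \<open>m - 1\<close> commutators with \<open>s\<close>.\<close>
  obtain k where k: "m = Suc k" using assms(5) by (cases m) auto
  have "e (\<psi> (?X s)) c = 0" if "c \<in> carrier A" for c
    using that s(1) t(2) by (simp add: \<psi>X e(2) v_def)
  from iterated_commutator[OF A X[OF t(1)] X[OF s(1)] this, of k] obtain w
    where w: "w \<in> lower_central F m"
      "\<And>c. c \<in> carrier A \<Longrightarrow> e (\<psi> w) c = (shift_diff A (h (?X s)) ^^ k) (e (\<psi> (?X t))) c"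
    using k by auto
  have "e (\<psi> w) c = 0" if "c \<in> carrier A" for c
    using crossed_vanishes_derived[OF G _ _ that] hN N(2) sub w(1) by blast
  \<comment> \<open>The two starting functions are known to agree only on \<open>carrier A\<close>,
    so agreement is propagated pointwise; shifts by \<open>h (?X s)\<close> stay in the
    carrier.\<close>
  moreover have "(shift_diff A (h (?X s)) ^^ k) (e (\<psi> (?X t))) c
      = (shift_diff A (h (?X s)) ^^ k) (\<lambda>c. of_bool (c = \<one>\<^bsub>A\<^esub>)) c" if "c \<in> carrier A" for c
    using that
  proof (induction k arbitrary: c)
    case 0
    then show ?case using t(1) by (simp add: \<psi>X e(2) v_def)
  next
    case (Suc k)
    then show ?case using X[OF s(1)] by (simp add: shift_diff_def)
  qed
  moreover obtain c where "c \<in> carrier A"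
    "(shift_diff A (h (?X s)) ^^ k) (\<lambda>c. of_bool (c = \<one>\<^bsub>A\<^esub>)) c \<noteq> (0::int)"
    using A.iterated_shift_diff_indicator[of "h (?X s)" k] s(2) X[OF s(1)] by auto
  ultimately show False using w(2)[of c] by simp
qed

end
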